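(* Let $\mathcal{I}$ be a fair division instance with additive valuations and let $0\le\epsilon<1/4$. Let $\hat{\mathcal{I}}=\mathtt{order}(\mathtt{normalize}(\mathtt{reduce}(\mathcal{I},\epsilon)))$. Then $\hat{\mathcal{I}}$ is ordered, normalized and $\left(\frac{3}{4}+\frac{4\epsilon}{1-4\epsilon}\right)$-irreducible (i.e. it is $\frac{4\epsilon}{1-4\epsilon}$-ONI). Furthermore, for any $\alpha$, from any $\alpha$-MMS allocation of $\hat{\mathcal{I}}$ one can obtain a $\min\left(\frac{3}{4}+\epsilon,(1-4\epsilon)\alpha\right)$-MMS allocation of $\mathcal{I}$.
   Context: An instance $(N,M,\mathcal{V})$ has agents $N=[n]$, a finite set $M$ of $m$ indivisible goods, and additive valuations $v_i:2^M\to\mathbb{R}_{\ge0}$. For a valuation $v$, set $S$ and integer $d\ge1$, $\mathrm{MMS}^d_v(S)$ is the maximum over partitions $(P_1,\dots,P_d)$ of $S$ into $d$ bundles of $\min_j v(P_j)$; $\mathrm{MMS}_i=\mathrm{MMS}^n_{v_i}(M)$, and a partition attaining it is an MMS partition of $i$. An allocation gives each agent $i$ a bundle $A_i\subseteq M$ (pairwise disjoint); it is $\beta$-MMS if $v_i(A_i)\ge\beta\,\mathrm{MMS}_i$ for all $i$. An instance is ordered if $M=[m]$ and $v_i(1)\ge\dots\ge v_i(m)$ for all agents $i$; it is normalized if every agent $i$ has an MMS partition $(P^i_1,\dots,P^i_n)$ with $v_i(P^i_j)=1$ for all $j$. $\mathtt{order}(([n],[m],\mathcal{V}))=([n],[m],\mathcal{V}')$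 where $v'_i(j)$ is the $j$-th largest number in the multiset $\{v_i(g):g\in[m]\}$. $\mathtt{normalize}$: for each agent $i$ compute an MMS partition $P^i$ of $i$ and for every $j\in[n]$ and $g\in P^i_j$ set $v'_i(g)=v_i(g)/v_i(P^i_j)$. Reduction rules for an ordered instance with $n$ agents and threshold $\alpha$: $R^\alpha_1$ applicable if some agent $i$ has $v_i(\{1\})\ge\alpha$; $R^\alpha_2$ if some $i$ has $v_i(\{2n-1,2n,2n+1\})\ge\alpha$; $R^\alpha_3$ if some $i$ has $v_i(\{3n-2,\dots,3n+1\})\ge\alpha$; $R^\alpha_4$ if some $i$ has $v_i(\{1,2n+1\})\ge\alpha$; applying it gives that set to such an agent and removes the agent and the goods, re-indexing remaining goods in order. An instance is $\alpha$-irreducible if none of $R^\alpha_1,\dots,R^\alpha_4$ is applicable; it is $\delta$-ONI if ordered, normalized and $(3/4+\delta)$-irreducible. $\mathtt{reduce}(\mathcal{I},\epsilon)$: (1) replace $\mathcal{I}$ by $\mathtt{order}(\mathcal{I})$; (2) set $v_i(g)\leftarrow v_i(g)/\mathrm{MMS}_i$ for all $i,g$; (3) while some $R^{3/4+\epsilon}_k$, $k\in[4]$, is applicable, apply it for the smallest applicable $k$; output the remaining agents, goods and valuations (agents removed in (3) keep the sets given to them). *)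

theory Defs
  imports Complex_Main "HOL-Library.Multiset"
begin

(* Agents: a finite set N :: 'a set (n = card N).  Goods: a finite set M :: 'g set.
   Additive valuations: v :: 'a => 'g => real, agent i values a set S at sum (v i) S.
   Ordered instances have goods M = {1..m} (type nat). *)

definition is_part :: "nat \<Rightarrow> 'g set \<Rightarrow> (nat \<Rightarrow> 'g set) \<Rightarrow> bool" where
  "is_part d S P \<longleftrightarrow> (\<forall>j<d. P j \<subseteq> S) \<and>
     (\<forall>j<d. \<forall>k<d. j \<noteq> k \<longrightarrow> P j \<inter> P k = {}) \<and> (\<Union>j<d. P j) = S"

definition min_bundle :: "nat \<Rightarrow> ('g \<Rightarrow> real) \<Rightarrow> (nat \<Rightarrow> 'g set) \<Rightarrow> real" where
  "min_bundle d v P = Min ((\<lambda>j. sum v (P j)) ` {..<d})"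

definition mms :: "nat \<Rightarrow> ('g \<Rightarrow> real) \<Rightarrow> 'g set \<Rightarrow> real" where
  "mms d v S = Max (min_bundle d v ` {P. is_part d S P})"

definition is_mms_partition :: "nat \<Rightarrow> ('g \<Rightarrow> real) \<Rightarrow> 'g set \<Rightarrow> (nat \<Rightarrow> 'g set) \<Rightarrow> bool" where
  "is_mms_partition d v S P \<longleftrightarrow> is_part d S P \<and> min_bundle d v P = mms d v S"

definition is_allocation :: "'a set \<Rightarrow> 'g set \<Rightarrow> ('a \<Rightarrow> 'g set) \<Rightarrow> bool" where
  "is_allocation N M A \<longleftrightarrow> (\<forall>i\<in>N. A i \<subseteq> M) \<and> (\<forall>i\<in>N. \<forall>j\<in>N. i \<noteq> j \<longrightarrow> A i \<inter> A j = {})"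

definition is_mms_alloc :: "real \<Rightarrow> 'a set \<Rightarrow> 'g set \<Rightarrow> ('a \<Rightarrow> 'g \<Rightarrow> real) \<Rightarrow> ('a \<Rightarrow> 'g set) \<Rightarrow> bool" where
  "is_mms_alloc \<beta> N M v A \<longleftrightarrow> is_allocation N M A \<and>
     (\<forall>i\<in>N. sum (v i) (A i) \<ge> \<beta> * mms (card N) (v i) M)"

definition ordered :: "'a set \<Rightarrow> nat set \<Rightarrow> ('a \<Rightarrow> nat \<Rightarrow> real) \<Rightarrow> bool" where
  "ordered N M v \<longleftrightarrow> M = {1..card M} \<and>
     (\<forall>i\<in>N. \<forall>g h. 1 \<le> g \<and> g \<le> h \<and> h \<le> card M \<longrightarrow> v i g \<ge> v i h)"

definition normalized :: "'a set \<Rightarrow> 'g set \<Rightarrow> ('a \<Rightarrow> 'g \<Rightarrow> real) \<Rightarrow> bool" where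
  "normalized N M v \<longleftrightarrow> (\<forall>i\<in>N. \<exists>P. is_mms_partition (card N) (v i) M P \<and>
     (\<forall>j<card N. sum (v i) (P j) = 1))"

definition rset :: "nat \<Rightarrow> nat \<Rightarrow> nat set" where
  "rset k n = (if k = 1 then {1}
     else if k = 2 then {2*n - 1, 2*n, 2*n + 1}
     else if k = 3 then {3*n - 2..3*n + 1}
     else {1, 2*n + 1})"

text \<open>R^alpha_k is applicable to the ordered instance (N, [m], v); goods with index > m
  do not exist and contribute nothing.\<close>
definition applicable :: "real \<Rightarrow> 'a set \<Rightarrow> nat \<Rightarrow> ('a \<Rightarrow> nat \<Rightarrow> real) \<Rightarrow> nat \<Rightarrow> bool" where
  "applicable \<alpha> N m v k \<longleftrightarrow> (\<exists>i\<in>N. sum (v i) (rset k (card N) \<inter> {1..m}) \<ge> \<alpha>)"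

definition irreducible :: "real \<Rightarrow> 'a set \<Rightarrow> nat set \<Rightarrow> ('a \<Rightarrow> nat \<Rightarrow> real) \<Rightarrow> bool" where
  "irreducible \<alpha> N M v \<longleftrightarrow> (\<forall>k\<in>{1..4}. \<not> applicable \<alpha> N (card M) v k)"

definition ONI :: "real \<Rightarrow> 'a set \<Rightarrow> nat set \<Rightarrow> ('a \<Rightarrow> nat \<Rightarrow> real) \<Rightarrow> bool" where
  "ONI \<delta> N M v \<longleftrightarrow> ordered N M v \<and> normalized N M v \<and> irreducible (3/4 + \<delta>) N M v"

definition order_val :: "('a \<Rightarrow> 'g \<Rightarrow> real) \<Rightarrow> 'g set \<Rightarrow> 'a \<Rightarrow> nat \<Rightarrow> real" where
  "order_val v M i j = (if 1 \<le> j \<and> j \<le> card M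
      then rev (sorted_list_of_multiset (image_mset (v i) (mset_set M))) ! (j - 1) else 0)"

text \<open>normalize (relational, since the MMS partitions are chosen arbitrarily):
  v' is a result of normalizing (N, M, v).\<close>
definition is_normalization :: "'a set \<Rightarrow> 'g set \<Rightarrow> ('a \<Rightarrow> 'g \<Rightarrow> real) \<Rightarrow> ('a \<Rightarrow> 'g \<Rightarrow> real) \<Rightarrow> bool" where
  "is_normalization N M v v' \<longleftrightarrow> (\<exists>P. (\<forall>i\<in>N. is_mms_partition (card N) (v i) M (P i)) \<and>
     (\<forall>i\<in>N. \<forall>j<card N. \<forall>g\<in>P i j. v' i g = v i g / sum (v i) (P i j)))"

definition remove_goods :: "nat \<Rightarrow> nat set \<Rightarrow> ('a \<Rightarrow> nat \<Rightarrow> real) \<Rightarrow> 'a \<Rightarrow> nat \<Rightarrow> real" where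
  "remove_goods m S v i j = v i (sorted_list_of_set ({1..m} - S) ! (j - 1))"

text \<open>Step (3) of reduce: repeatedly apply the smallest applicable rule (to any agent
  for which it is applicable) until none is applicable.  Relational, since the agent is
  not determined.\<close>
inductive reduce_run :: "real \<Rightarrow> 'a set \<Rightarrow> nat \<Rightarrow> ('a \<Rightarrow> nat \<Rightarrow> real) \<Rightarrow>
    'a set \<Rightarrow> nat \<Rightarrow> ('a \<Rightarrow> nat \<Rightarrow> real) \<Rightarrow> bool" for \<alpha> where
  stop: "(\<forall>k\<in>{1..4}. \<not> applicable \<alpha> N m v k) \<Longrightarrow> reduce_run \<alpha> N m v N m v"
| step: "\<lbrakk> k \<in> {1..4}; \<forall>k'\<in>{1..<k}. \<not> applicable \<alpha> N m v k'; i \<in> N;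
          sum (v i) (rset k (card N) \<inter> {1..m}) \<ge> \<alpha>;
          reduce_run \<alpha> (N - {i}) (m - card (rset k (card N) \<inter> {1..m}))
             (remove_goods m (rset k (card N)) v) N' m' v' \<rbrakk>
        \<Longrightarrow> reduce_run \<alpha> N m v N' m' v'"

definition reduce_rel :: "real \<Rightarrow> 'a set \<Rightarrow> 'g set \<Rightarrow> ('a \<Rightarrow> 'g \<Rightarrow> real) \<Rightarrow>
    'a set \<Rightarrow> nat \<Rightarrow> ('a \<Rightarrow> nat \<Rightarrow> real) \<Rightarrow> bool" where
  "reduce_rel \<epsilon> N M v N' m' v' \<longleftrightarrow>
     (let v1 = order_val v M;
          v2 = (\<lambda>i g. v1 i g / mms (card N) (v1 i) {1..card M})
      in reduce_run (3/4 + \<epsilon>) N (card M) v2 N' m' v')"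

end

theory Submission
  imports Defs "HOL-Library.Disjoint_Sets"
begin

text \<open>Write \<open>u = 1/4 - \<epsilon>\<close>, so that the reduction rules have threshold \<open>1 - u\<close>. The point is that every
  remaining agent still has maximin share at least \<open>4u = 1 - 4\<epsilon>\<close> after the reduction; then normalizing
  multiplies no value by more than \<open>1/(1 - 4\<epsilon>)\<close>.

  Rule \<open>R\<^sub>4\<close> can lower the maximin share, and it may be interleaved with the other rules, so the
  induction needs a finer measure than value. Place four equidistant levels from \<open>u\<close> to \<open>1\<close>: a set whose
  value reaches the \<open>c\<close>-th level is worth \<open>c\<close> units, and units of disjoint sets add up. Since \<open>u \<le> 1/4\<close>,
  four units have value at least \<open>4u\<close>. The invariant is that there is one bundle of four units per
  remaining agent. Units do not decrease when goods are replaced by better ones, so \<open>R\<^sub>1\<close>, \<open>R\<^sub>2\<close>, \<open>R\<^sub>3\<close>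
  preserve the invariant by the usual pigeonhole and exchange argument. When \<open>R\<^sub>4\<close> is applied, \<open>R\<^sub>1\<close> and
  \<open>R\<^sub>2\<close> are not applicable, so good \<open>1\<close> has value below \<open>1 - u\<close> and costs its bundle at most three
  units, and good \<open>2n + 1\<close> has value below \<open>(1 - u)/3\<close>, one level, and costs at most one; what is left
  of the two bundles is merged into one with four units.\<close>

section \<open>Maximin shares\<close>

text \<open>A partition is a function on all naturals, so there are infinitely many of them, but
  \<open>min_bundle\<close> sees only the first \<open>d\<close> values, each a subset of the finite
  \<open>S\<close>. This is what makes the \<open>Max\<close> in \<open>mms\<close>
  meaningful.\<close>

lemma finite_min_bundle_image:
  assumes "finite S"
  shows "finite (min_bundle d v ` {P. is_part d S P})"
proof (rule finite_subset)
  show "min_bundle d v ` {P. is_part d S P} \<subseteq> min_bundle d v ` (PiE {..<d} (\<lambda>_. Pow S))"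
  proof
    fix x assume "x \<in> min_bundle d v ` {P. is_part d S P}"
    then obtain P where P: "is_part d S P" "x = min_bundle d v P" by auto
    have "min_bundle d v P = min_bundle d v (restrict P {..<d})"
      unfolding min_bundle_def by (intro arg_cong[where f = Min] image_cong) auto
    moreover have "restrict P {..<d} \<in> PiE {..<d} (\<lambda>_. Pow S)"
      using P(1) by (auto simp: is_part_def)
    ultimately show "x \<in> min_bundle d v ` (PiE {..<d} (\<lambda>_. Pow S))" using P(2) by auto
  qed
  show "finite (min_bundle d v ` (PiE {..<d} (\<lambda>_. Pow S)))"
    using assms by (intro finite_imageI finite_PiE) auto
qed

lemma le_min_bundle_iff:
  "d > 0 \<Longrightarrow> c \<le> min_bundle d v P \<longleftrightarrow> (\<forall>j<d. c \<le> sum v (P j))"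
  unfolding min_bundle_def by (subst Min_ge_iff) auto

lemma min_bundle_le_mms:
  "finite S \<Longrightarrow> is_part d S P \<Longrightarrow> min_bundle d v P \<le> mms d v S"
  unfolding mms_def by (rule Max_ge) (auto intro: finite_min_bundle_image)

lemma mms_partition_exists:
  assumes "finite S" "d > 0"
  shows "\<exists>P. is_mms_partition d v S P"
proof -
  have "is_part d S (\<lambda>j. if j = 0 then S else {})"
    using assms(2) by (auto simp: is_part_def split: if_splits)
  then have "min_bundle d v ` {P. is_part d S P} \<noteq> {}" by blast
  from Max_in[OF finite_min_bundle_image[OF assms(1)] this] show ?thesis
    unfolding mms_def[symmetric] is_mms_partition_def by auto
qed

text \<open>Replaces the nested \<open>Max\<close> and \<open>Min\<close> by a witness partition;
  nearly all later reasoning about \<open>mms\<close> goes through this form.\<close>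

lemma le_mms_iff:
  assumes "finite S" "d > 0"
  shows "c \<le> mms d v S \<longleftrightarrow> (\<exists>P. is_part d S P \<and> (\<forall>j<d. c \<le> sum v (P j)))"
proof
  assume c: "c \<le> mms d v S"
  obtain P where "is_part d S P" "min_bundle d v P = mms d v S"
    using mms_partition_exists[OF assms] unfolding is_mms_partition_def by blast
  with c le_min_bundle_iff[OF assms(2)] show "\<exists>P. is_part d S P \<and> (\<forall>j<d. c \<le> sum v (P j))"
    by metis
next
  assume "\<exists>P. is_part d S P \<and> (\<forall>j<d. c \<le> sum v (P j))"
  then show "c \<le> mms d v S"
    using min_bundle_le_mms[OF assms(1)] le_min_bundle_iff[OF assms(2)] order_trans by metis
qed

lemma is_part_image:
  assumes "bij_betw s S T" "is_part d S P"
  shows "is_part d T (\<lambda>j. s ` P j)"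
proof -
  have T: "T = s ` S" and inj: "inj_on s S" using assms(1) by (auto simp: bij_betw_def)
  have "s ` P j \<inter> s ` P k = {}" if "j < d" "k < d" "j \<noteq> k" for j k
  proof -
    have "P j \<subseteq> S" "P k \<subseteq> S" "P j \<inter> P k = {}" using assms(2) that by (auto simp: is_part_def)
    then show ?thesis using inj_on_image_Int[OF inj, of "P j" "P k"] by simp
  qed
  moreover have "(\<Union>j<d. s ` P j) = T"
    using assms(2) unfolding T is_part_def by (metis image_UN)
  ultimately show ?thesis unfolding is_part_def by blast
qed

lemma is_part_subset: "is_part d S P \<Longrightarrow> j < d \<Longrightarrow> P j \<subseteq> S"
  by (auto simp: is_part_def)

lemma sum_bij_image:
  assumes "bij_betw s S T" "A \<subseteq> S" "\<And>x. x \<in> S \<Longrightarrow> w x = v (s x)"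
  shows "sum v (s ` A) = sum w A"
proof -
  have "inj_on s A" using assms by (auto simp: bij_betw_def intro: inj_on_subset)
  then show ?thesis using assms(2,3) by (auto simp: sum.reindex intro!: sum.cong)
qed

lemma mms_le_mms_bij:
  assumes "bij_betw s S T" "finite S" "d > 0" "\<And>x. x \<in> S \<Longrightarrow> w x = v (s x)"
  shows "mms d w S \<le> mms d v T"
proof -
  obtain P where P: "is_part d S P" "\<forall>j<d. mms d w S \<le> sum w (P j)"
    using le_mms_iff[OF assms(2,3), of "mms d w S" w] by auto
  have "\<forall>j<d. mms d w S \<le> sum v (s ` P j)"
    using P sum_bij_image[where v = v and w = w, OF assms(1) is_part_subset[OF P(1)] assms(4)] by simp
  moreover have "finite T" using assms(1,2) bij_betw_finite by blast
  ultimately show ?thesis using is_part_image[OF assms(1) P(1)] le_mms_iff[of T d] assms(3) by blast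
qed

lemma mms_bij:
  assumes "bij_betw s S T" "finite S" "d > 0" "\<And>x. x \<in> S \<Longrightarrow> w x = v (s x)"
  shows "mms d w S = mms d v T"
proof (rule antisym)
  have "v y = w (the_inv_into S s y)" if "y \<in> T" for y
    using that assms(1,4) f_the_inv_into_f_bij_betw[OF assms(1), of y]
      bij_betwE[OF bij_betw_the_inv_into[OF assms(1)]] by metis
  moreover have "finite T" using assms(1,2) bij_betw_finite by blast
  ultimately show "mms d v T \<le> mms d w S"
    using mms_le_mms_bij[OF bij_betw_the_inv_into[OF assms(1)]] assms(3) by blast
  show "mms d w S \<le> mms d v T" using assms by (rule mms_le_mms_bij)
qed

text \<open>A disjoint family that misses some goods can be completed to a partition: the missing
  goods have nonnegative value and may join any bundle.\<close>

lemma le_mms_disjoint_family: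
  assumes "finite S" "finite J" "card J = d" "d > 0" "\<And>g. g \<in> S \<Longrightarrow> 0 \<le> v g"
    and sub: "\<And>j. j \<in> J \<Longrightarrow> P j \<subseteq> S" and disj: "disjoint_family_on P J"
    and ge: "\<And>j. j \<in> J \<Longrightarrow> c \<le> sum v (P j)"
  shows "c \<le> mms d v S"
proof -
  obtain b where b: "bij_betw b {..<d} J"
    using ex_bij_betw_nat_finite[OF assms(2)] assms(3) by (auto simp: atLeast0LessThan)
  have bJ: "b j \<in> J" if "j < d" for j using b that by (auto simp: bij_betw_def)
  \<comment> \<open>Bundle \<open>0\<close> absorbs all goods outside the family; it exists since
    \<open>d > 0\<close>.\<close>
  define Q where "Q j = (if j = 0 then P (b 0) \<union> (S - (\<Union>k\<in>J. P k)) else P (b j))" for j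
  have dis: "P (b j) \<inter> P (b k) = {}" if "j < d" "k < d" "j \<noteq> k" for j k
  proof -
    have "b j \<noteq> b k" using b that by (auto simp: bij_betw_def inj_on_def)
    then show ?thesis using disjoint_family_onD[OF disj bJ[OF that(1)] bJ[OF that(2)]] by blast
  qed
  have "is_part d S Q"
    unfolding is_part_def
  proof (intro conjI allI impI)
    fix j assume "j < d" then show "Q j \<subseteq> S"
      using sub[OF bJ] assms(4) by (auto simp: Q_def split: if_splits)
  next
    fix j k assume jk: "j < d" "k < d" "j \<noteq> k"
    show "Q j \<inter> Q k = {}"
      using dis[OF jk] bJ[OF jk(1)] bJ[OF jk(2)] jk(3) by (auto simp: Q_def split: if_splits)
  next
    show "(\<Union>j<d. Q j) = S"
    proof
      show "(\<Union>j<d. Q j) \<subseteq> S"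
        using sub[OF bJ] assms(4) by (auto simp: Q_def split: if_splits)
      show "S \<subseteq> (\<Union>j<d. Q j)"
      proof
        fix x assume x: "x \<in> S"
        show "x \<in> (\<Union>j<d. Q j)"
        proof (cases "\<exists>k\<in>J. x \<in> P k")
          case True
          then obtain j where "j < d" "x \<in> P (b j)" using b by (force simp: bij_betw_def)
          then show ?thesis by (auto simp: Q_def intro!: bexI[of _ j])
        next
          case False
          then show ?thesis using x assms(4) by (auto simp: Q_def intro!: bexI[of _ 0])
        qed
      qed
    qed
  qed
  moreover have "c \<le> sum v (Q j)" if "j < d" for j
  proof -
    have "sum v (P (b j)) \<le> sum v (Q j)"
      using that sub[OF bJ] assms(1,4,5)
      by (intro sum_mono2) (auto simp: Q_def intro: finite_subset split: if_splits)
    then show ?thesis using ge[OF bJ[OF that]] by linarith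
  qed
  ultimately show ?thesis using le_mms_iff[OF assms(1,4)] by blast
qed

text \<open>By averaging: every partition has the same total \<open>d * c\<close>, so its least
  bundle is worth at most \<open>c\<close>.\<close>

lemma mms_eq_if_equal_bundles:
  assumes "finite S" "d > 0" "is_part d S P" "\<And>j. j < d \<Longrightarrow> sum v (P j) = c"
  shows "mms d v S = c"
proof (rule antisym)
  have total: "(\<Sum>j<d. sum v (Q j)) = sum v S" if "is_part d S Q" for Q
  proof -
    have "sum v (\<Union>j<d. Q j) = (\<Sum>j<d. sum v (Q j))"
      using that assms(1) by (intro sum.UNION_disjoint) (auto simp: is_part_def intro: finite_subset)
    then show ?thesis using that by (simp add: is_part_def)
  qed
  obtain Q where Q: "is_part d S Q" "\<forall>j<d. mms d v S \<le> sum v (Q j)"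
    using le_mms_iff[OF assms(1,2), of "mms d v S" v] by auto
  have "real d * mms d v S \<le> (\<Sum>j<d. sum v (Q j))"
    using sum_mono[of "{..<d}" "\<lambda>_. mms d v S" "\<lambda>j. sum v (Q j)"] Q(2) by simp
  also have "\<dots> = (\<Sum>j<d. sum v (P j))" using total Q(1) assms(3) by metis
  also have "\<dots> = real d * c" using assms(4) by simp
  finally show "mms d v S \<le> c" using assms(2) by simp
  show "c \<le> mms d v S" using le_mms_iff[OF assms(1,2)] assms(3,4) by (metis order_refl)
qed

section \<open>Ordering the goods\<close>

lemma ordered_interval_iff:
  "ordered N {1..m} v \<longleftrightarrow> (\<forall>i\<in>N. \<forall>g h. 1 \<le> g \<and> g \<le> h \<and> h \<le> m \<longrightarrow> v i h \<le> v i g)"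
  by (simp add: ordered_def)

lemma order_val_antimono:
  assumes "1 \<le> g" "g \<le> h" "h \<le> card M"
  shows "order_val v M i h \<le> order_val v M i g"
proof -
  define L where "L = sorted_list_of_multiset (image_mset (v i) (mset_set M))"
  have "sorted (rev (rev L))" by (simp add: L_def sorted_sorted_list_of_multiset)
  moreover have "length L = card M"
    unfolding L_def by (metis mset_sorted_list_of_multiset size_image_mset size_mset size_mset_set)
  ultimately have "rev L ! (h - 1) \<le> rev L ! (g - 1)"
    using assms by (intro sorted_rev_nth_mono) auto
  then show ?thesis using assms by (simp add: order_val_def L_def)
qed

lemma ordered_order_val: "ordered N {1..card M} (order_val v M)"
  unfolding ordered_interval_iff by (auto intro: order_val_antimono)

text \<open>For one fixed agent, sorting the values is only a relabelling of the goods. The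
  bijection depends on the agent.\<close>

lemma order_val_bij:
  assumes "finite M"
  obtains s where "bij_betw s {1..card M} M"
    "\<And>j. j \<in> {1..card M} \<Longrightarrow> order_val v M i j = v i (s j)"
proof -
  obtain xs where xs: "set xs = M" "distinct xs" using finite_distinct_list[OF assms] by blast
  define ys where "ys = rev (sort_key (v i) xs)"
  have len: "length ys = card M" using xs by (simp add: ys_def flip: distinct_card)
  have "mset_set M = mset xs" using xs mset_set_set by blast
  then have "sorted_list_of_multiset (image_mset (v i) (mset_set M)) = sort (map (v i) xs)"
    by (metis mset_map sorted_list_of_multiset_mset)
  also have "\<dots> = map (v i) (sort_key (v i) xs)"
    by (intro properties_for_sort) auto
  finally have L: "rev (sorted_list_of_multiset (image_mset (v i) (mset_set M))) = map (v i) ys"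
    by (simp add: ys_def rev_map)
  have "bij_betw (\<lambda>j. j - 1) {1..card M} {..<length ys}"
    by (rule bij_betw_byWitness[where f' = Suc]) (auto simp: len)
  moreover have "bij_betw ((!) ys) {..<length ys} M"
    by (rule bij_betw_nth) (use xs in \<open>auto simp: ys_def\<close>)
  ultimately have "bij_betw ((!) ys \<circ> (\<lambda>j. j - 1)) {1..card M} M" by (rule bij_betw_trans)
  then show ?thesis
    by (rule that) (use len L in \<open>auto simp: order_val_def\<close>)
qed

text \<open>Sorting keeps a pointwise upper bound that is itself nonincreasing: of the goods behind
  the \<open>j\<close> largest values, one has index at least \<open>j\<close>, and \<open>c\<close>
  is at most \<open>c j\<close> there. Needed because normalizing may destroy the order of the
  goods.\<close>

lemma order_val_le:
  assumes le: "\<And>g. g \<in> {1..m} \<Longrightarrow> w i g \<le> c g"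
    and anti: "\<And>g h. 1 \<le> g \<Longrightarrow> g \<le> h \<Longrightarrow> h \<le> m \<Longrightarrow> c h \<le> c g"
    and j: "j \<in> {1..m}"
  shows "order_val w {1..m} i j \<le> c j"
proof -
  obtain s where s: "bij_betw s {1..m} {1..m}"
    "\<And>j. j \<in> {1..m} \<Longrightarrow> order_val w {1..m} i j = w i (s j)"
    using order_val_bij[of "{1..m}" w i] by auto
  have "inj_on s {1..j}" using s(1) j by (auto simp: bij_betw_def intro: inj_on_subset)
  then have "card (s ` {1..j}) = j" by (simp add: card_image)
  then have "\<not> s ` {1..j} \<subseteq> {1..<j}"
    using card_mono[of "{1..<j}" "s ` {1..j}"] j by auto
  then obtain t where t: "t \<in> {1..j}" "s t \<notin> {1..<j}" by blast
  moreover have "s t \<in> {1..m}" using s(1) j t(1) by (auto simp: bij_betw_def)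
  ultimately have t: "t \<in> {1..j}" "s t \<in> {1..m}" "j \<le> s t" by auto
  have "order_val w {1..m} i j \<le> order_val w {1..m} i t"
    using t j by (intro order_val_antimono) auto
  also have "\<dots> = w i (s t)" using t j by (intro s(2)) auto
  also have "\<dots> \<le> c (s t)" using le t by auto
  also have "\<dots> \<le> c j" using anti t j by auto
  finally show ?thesis .
qed

text \<open>Picking sequence: going through the goods \<open>1, 2, \<dots>\<close> of the ordered instance, the owner of
  \<open>j\<close> picks a good of \<open>M\<close>; only \<open>j - 1\<close> goods are gone, so one of the owner's best \<open>j\<close> is left.\<close>

lemma picking_sequence:
  assumes fin: "finite M" and A: "is_allocation N {1..card M} A" and t: "t \<le> card M"
  shows "\<exists>f. inj_on f {1..t} \<and> f ` {1..t} \<subseteq> M \<and>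
    (\<forall>j\<in>{1..t}. \<forall>i\<in>N. j \<in> A i \<longrightarrow> order_val v M i j \<le> v i (f j))"
  using t
proof (induction t)
  case (Suc t)
  then obtain f where f: "inj_on f {1..t}" "f ` {1..t} \<subseteq> M"
    "\<And>j i. j \<in> {1..t} \<Longrightarrow> i \<in> N \<Longrightarrow> j \<in> A i \<Longrightarrow> order_val v M i j \<le> v i (f j)" by auto
  have cf: "card (f ` {1..t}) = t" using f(1) by (simp add: card_image)
  have "\<exists>g. g \<in> M - f ` {1..t} \<and> (\<forall>i\<in>N. Suc t \<in> A i \<longrightarrow> order_val v M i (Suc t) \<le> v i g)"
  proof (cases "\<exists>i\<in>N. Suc t \<in> A i")
    case True
    then obtain i where i: "i \<in> N" "Suc t \<in> A i" by blast
    have uniq: "k = i" if "k \<in> N" "Suc t \<in> A k" for k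
      using that i A unfolding is_allocation_def by blast
    obtain s where s: "bij_betw s {1..card M} M"
      "\<And>j. j \<in> {1..card M} \<Longrightarrow> order_val v M i j = v i (s j)"
      by (rule order_val_bij[OF fin, of v i]) blast
    have "inj_on s {1..Suc t}" using s(1) Suc.prems by (auto simp: bij_betw_def intro: inj_on_subset)
    then have "card (s ` {1..Suc t}) = Suc t" by (simp add: card_image)
    then have "\<not> s ` {1..Suc t} \<subseteq> f ` {1..t}" using cf card_mono[of "f ` {1..t}" "s ` {1..Suc t}"] by auto
    then obtain r where r: "r \<in> {1..Suc t}" "s r \<notin> f ` {1..t}" by blast
    have "order_val v M i (Suc t) \<le> order_val v M i r"
      using r Suc.prems by (intro order_val_antimono) auto
    also have "\<dots> = v i (s r)" using r Suc.prems by (intro s(2)) auto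
    finally have "order_val v M i (Suc t) \<le> v i (s r)" .
    moreover have "s r \<in> M" using s(1) r Suc.prems by (auto simp: bij_betw_def)
    ultimately show ?thesis using r uniq by blast
  next
    case False
    have "\<not> M \<subseteq> f ` {1..t}" using cf Suc.prems card_mono[of "f ` {1..t}" M] by auto
    then show ?thesis using False by blast
  qed
  then obtain g where g: "g \<in> M" "g \<notin> f ` {1..t}"
    "\<And>i. i \<in> N \<Longrightarrow> Suc t \<in> A i \<Longrightarrow> order_val v M i (Suc t) \<le> v i g" by blast
  have ins: "{1..Suc t} = insert (Suc t) {1..t}" by auto
  have "inj_on (f(Suc t := g)) {1..t}" using f(1) g(2) by (rule inj_on_fun_updI)
  moreover have "(f(Suc t := g)) ` {1..t} = f ` {1..t}" by (rule image_cong) auto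
  ultimately have "inj_on (f(Suc t := g)) {1..Suc t}"
    unfolding ins using g(2) by (auto simp: inj_on_insert)
  moreover have "(f(Suc t := g)) ` {1..Suc t} \<subseteq> M" using f(2) g(1) by (auto simp: ins)
  moreover have "\<forall>j\<in>{1..Suc t}. \<forall>i\<in>N. j \<in> A i \<longrightarrow>
      order_val v M i j \<le> v i ((f(Suc t := g)) j)"
    using f(3) g(3) by (auto simp: ins)
  ultimately show ?case by blast
qed auto

lemma is_allocation_image:
  assumes "is_allocation N S A" "inj_on f S" "f ` S \<subseteq> T"
  shows "is_allocation N T (\<lambda>i. f ` A i)"
proof -
  have "f ` A i \<inter> f ` A j = {}" if "i \<in> N" "j \<in> N" "i \<noteq> j" for i j
  proof -
    have "A i \<subseteq> S" "A j \<subseteq> S" "A i \<inter> A j = {}" using assms(1) that by (auto simp: is_allocation_def)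
    then show ?thesis using inj_on_image_Int[OF assms(2), of "A i" "A j"] by simp
  qed
  then show ?thesis using assms unfolding is_allocation_def by blast
qed

text \<open>The completed picking sequence. It undoes both sorting steps of the construction, the
  one after \<open>normalize\<close> and the one at the start of \<open>reduce\<close>.\<close>

lemma unorder_allocation:
  assumes "finite M" and A: "is_allocation N {1..card M} A"
  obtains B where "is_allocation N M B"
    "\<And>i. i \<in> N \<Longrightarrow> sum (order_val v M i) (A i) \<le> sum (v i) (B i)"
proof -
  obtain f where f: "inj_on f {1..card M}" "f ` {1..card M} \<subseteq> M"
    "\<And>j i. j \<in> {1..card M} \<Longrightarrow> i \<in> N \<Longrightarrow> j \<in> A i \<Longrightarrow> order_val v M i j \<le> v i (f j)"
    using picking_sequence[OF assms order_refl, of v] by blast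
  have "sum (order_val v M i) (A i) \<le> sum (v i) (f ` A i)" if i: "i \<in> N" for i
  proof -
    have Ai: "A i \<subseteq> {1..card M}" using A i by (auto simp: is_allocation_def)
    then have "inj_on f (A i)" using f(1) inj_on_subset by blast
    then show ?thesis using Ai f(3) i by (auto simp: sum.reindex intro!: sum_mono)
  qed
  then show ?thesis by (rule that[OF is_allocation_image[OF A f(1,2)]])
qed

section \<open>Units\<close>

text \<open>A relation rather than a function: \<open>units u v S c\<close> says that some way of
  splitting \<open>S\<close> into disjoint pieces certifies \<open>c\<close> units, so additivity is
  built in. Level \<open>1\<close> is \<open>u\<close>, level \<open>4\<close> is \<open>1\<close>,
  and consecutive levels differ by \<open>(1 - u) / 3\<close>.\<close>

inductive units :: "real \<Rightarrow> ('g \<Rightarrow> real) \<Rightarrow> 'g set \<Rightarrow> nat \<Rightarrow> bool" for u v where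
  zero: "finite S \<Longrightarrow> units u v S 0"
| level: "finite S \<Longrightarrow> c \<in> {1..4} \<Longrightarrow> u + (real c - 1) * ((1 - u) / 3) \<le> sum v S \<Longrightarrow> units u v S c"
| union: "units u v S a \<Longrightarrow> units u v T b \<Longrightarrow> S \<inter> T = {} \<Longrightarrow> units u v (S \<union> T) (a + b)"

lemma units_finite: "units u v S c \<Longrightarrow> finite S"
  by (induction rule: units.induct) auto

lemma units_weaken:
  assumes "units u v S c" "d \<le> c" "u \<le> 1"
  shows "units u v S d"
  using assms(1,2)
proof (induction arbitrary: d rule: units.induct)
  case (zero S)
  then show ?case by (auto intro: units.zero)
next
  case (level S c)
  show ?case
  proof (cases "d = 0")
    case True
    then show ?thesis using level by (auto intro: units.zero)
  next
    case False
    have "(real d - 1) * ((1 - u) / 3) \<le> (real c - 1) * ((1 - u) / 3)"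
      using level assms(3) by (intro mult_right_mono) auto
    then show ?thesis using level False by (intro units.level) auto
  qed
next
  case (union S a T b)
  \<comment> \<open>The demand \<open>d\<close> is met from \<open>S\<close> as far as possible, the
    rest from \<open>T\<close>.\<close>
  have "units u v S (min d a)" by (rule union.IH(1)) simp
  moreover have "units u v T (d - min d a)" by (rule union.IH(2)) (use union.prems in auto)
  ultimately have "units u v (S \<union> T) (min d a + (d - min d a))"
    using union.hyps(3) by (rule units.union)
  then show ?case by simp
qed

text \<open>For \<open>u \<le> 1/4\<close> the gap \<open>(1 - u) / 3\<close> between levels is at
  least \<open>u\<close>, so reaching level \<open>c\<close> means a value of at least
  \<open>c * u\<close>.\<close>

lemma units_le_sum:
  assumes "units u v S c" "u \<le> 1/4" "\<And>g. g \<in> S \<Longrightarrow> 0 \<le> v g"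
  shows "real c * u \<le> sum v S"
  using assms(1,3)
proof (induction rule: units.induct)
  case (zero S)
  then show ?case by (simp add: sum_nonneg)
next
  case (level S c)
  have "(real c - 1) * u \<le> (real c - 1) * ((1 - u) / 3)"
    using assms(2) level by (intro mult_left_mono) auto
  moreover have "real c * u = u + (real c - 1) * u" by (simp add: algebra_simps)
  ultimately show ?case using level by linarith
next
  case (union S a T b)
  have "sum v (S \<union> T) = sum v S + sum v T"
    using union units_finite by (intro sum.union_disjoint) auto
  then show ?case using union by (auto simp: algebra_simps)
qed

lemma units_image:
  assumes "units u v S c" "inj_on f S" "\<And>g. g \<in> S \<Longrightarrow> v g \<le> w (f g)"
  shows "units u w (f ` S) c"
  using assms
proof (induction rule: units.induct)
  case (zero S)
  then show ?case by (auto intro: units.zero)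
next
  case (level S c)
  have "sum v S \<le> sum w (f ` S)"
    using level by (auto simp: sum.reindex intro!: sum_mono)
  then show ?case using level by (intro units.level) auto
next
  case (union S a T b)
  have "f ` S \<inter> f ` T = {}"
    using inj_on_image_Int[OF union.prems(1), of S T] union.hyps by auto
  moreover have "units u w (f ` S) a" "units u w (f ` T) b"
    using union by (auto simp: inj_on_Un)
  ultimately show ?case using units.union by (metis image_Un)
qed

lemma sum_diff_singleton_ge:
  fixes v :: "'g \<Rightarrow> real"
  assumes "finite S" "0 \<le> v x"
  shows "sum v S - v x \<le> sum v (S - {x})"
  using assms by (simp add: sum_diff1)

text \<open>Only the piece containing \<open>x\<close> is affected, and it loses at most one gap,
  hence at most one level.\<close>

lemma units_remove_small:
  assumes "units u v S c" "0 \<le> v x" "v x \<le> (1 - u) / 3" "u \<le> 1"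
  shows "units u v (S - {x}) (c - 1)"
  using assms(1)
proof (induction rule: units.induct)
  case (zero S)
  then show ?case by (auto intro: units.zero)
next
  case (level S c)
  show ?case
  proof (cases "c = 1")
    case True
    then show ?thesis using level by (auto intro: units.zero)
  next
    case False
    have "u + (real (c - 1) - 1) * ((1 - u) / 3) = u + (real c - 1) * ((1 - u) / 3) - (1 - u) / 3"
      using level by (simp add: of_nat_diff field_simps)
    also have "\<dots> \<le> sum v (S - {x})"
      using sum_diff_singleton_ge[of S v x] level assms by linarith
    finally show ?thesis using level False by (intro units.level) auto
  qed
next
  case (union S a T b)
  show ?case
  proof (cases "x \<in> S")
    case True
    then have "(S \<union> T) - {x} = (S - {x}) \<union> T" using union.hyps by auto
    then have "units u v ((S \<union> T) - {x}) ((a - 1) + b)"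
      using units.union[OF union.IH(1) union.hyps(2)] union.hyps by auto
    \<comment> \<open>Subtraction is truncated, so for \<open>a = 0\<close> the left side
      \<open>(a - 1) + b\<close> may exceed \<open>a + b - 1\<close>.\<close>
    then show ?thesis by (rule units_weaken) (use assms in auto)
  next
    case False
    then have "(S \<union> T) - {x} = S \<union> (T - {x})" by auto
    then have "units u v ((S \<union> T) - {x}) (a + (b - 1))"
      using units.union[OF union.hyps(1) union.IH(2)] union.hyps by auto
    then show ?thesis by (rule units_weaken) (use assms in auto)
  qed
qed

text \<open>Only the piece containing \<open>x\<close> is affected. If it reaches level
  \<open>4\<close>, its value is at least \<open>1\<close> and at least \<open>u\<close> remains,
  which is level \<open>1\<close>; at lower levels nothing has to remain.\<close>

lemma units_remove_large:
  assumes "units u v S c" "0 \<le> v x" "v x \<le> 1 - u" "u \<le> 1"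
  shows "units u v (S - {x}) (c - 3)"
  using assms(1)
proof (induction rule: units.induct)
  case (zero S)
  then show ?case by (auto intro: units.zero)
next
  case (level S c)
  show ?case
  proof (cases "c = 4")
    case True
    then have "u + (4 - 1) * ((1 - u) / 3) \<le> sum v S" using level by simp
    then have "1 \<le> sum v S" by (simp add: field_simps)
    then have "u \<le> sum v (S - {x})"
      using sum_diff_singleton_ge[of S v x] level assms by linarith
    then show ?thesis using level True by (intro units.level) auto
  next
    case False
    then show ?thesis using level by (auto intro: units.zero)
  qed
next
  case (union S a T b)
  show ?case
  proof (cases "x \<in> S")
    case True
    then have "(S \<union> T) - {x} = (S - {x}) \<union> T" using union.hyps by auto
    then have "units u v ((S \<union> T) - {x}) ((a - 3) + b)"
      using units.union[OF union.IH(1) union.hyps(2)] union.hyps by auto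
    then show ?thesis by (rule units_weaken) (use assms in auto)
  next
    case False
    then have "(S \<union> T) - {x} = S \<union> (T - {x})" by auto
    then have "units u v ((S \<union> T) - {x}) (a + (b - 3))"
      using units.union[OF union.hyps(1) union.IH(2)] union.hyps by auto
    then show ?thesis by (rule units_weaken) (use assms in auto)
  qed
qed

text \<open>The bundles need not cover the set of goods.\<close>

definition unit_bundles :: "real \<Rightarrow> (nat \<Rightarrow> real) \<Rightarrow> nat set \<Rightarrow> nat \<Rightarrow> bool" where
  "unit_bundles u v G n \<longleftrightarrow> (\<exists>(J :: nat set) P. finite J \<and> card J = n \<and> disjoint_family_on P J \<and>
     (\<forall>j\<in>J. P j \<subseteq> G \<and> units u v (P j) 4))"

lemma unit_bundles_mms:
  assumes "unit_bundles u v G n" "finite G" "n > 0" "u \<le> 1/4" "\<And>g. g \<in> G \<Longrightarrow> 0 \<le> v g"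
  shows "4 * u \<le> mms n v G"
proof -
  obtain J :: "nat set" and P where J: "finite J" "card J = n" "disjoint_family_on P J"
    "\<And>j. j \<in> J \<Longrightarrow> P j \<subseteq> G" "\<And>j. j \<in> J \<Longrightarrow> units u v (P j) 4"
    using assms(1) unfolding unit_bundles_def by blast
  have "4 * u \<le> sum v (P j)" if "j \<in> J" for j
    using units_le_sum[OF J(5)[OF that] assms(4)] J(4)[OF that] assms(5) by auto
  with assms J show ?thesis by (intro le_mms_disjoint_family[of G J n v P]) auto
qed

lemma unit_bundles_image:
  assumes "unit_bundles u v G n" "inj_on f G" "f ` G \<subseteq> H" "\<And>g. g \<in> G \<Longrightarrow> v g \<le> w (f g)"
  shows "unit_bundles u w H n"
proof -
  obtain J :: "nat set" and P where J: "finite J" "card J = n" "disjoint_family_on P J"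
    "\<And>j. j \<in> J \<Longrightarrow> P j \<subseteq> G" "\<And>j. j \<in> J \<Longrightarrow> units u v (P j) 4"
    using assms(1) unfolding unit_bundles_def by blast
  have "disjoint_family_on (\<lambda>j. f ` P j) J"
    unfolding disjoint_family_on_def
  proof (intro ballI impI)
    fix j k assume jk: "j \<in> J" "k \<in> J" "j \<noteq> k"
    then have "P j \<inter> P k = {}" using J(3) by (auto simp: disjoint_family_on_def)
    then show "f ` P j \<inter> f ` P k = {}"
      using inj_on_image_Int[OF assms(2) J(4)[OF jk(1)] J(4)[OF jk(2)]] by simp
  qed
  moreover have "units u w (f ` P j) 4" if "j \<in> J" for j
    using J(4)[OF that] assms(2,4)
    by (intro units_image[OF J(5)[OF that]]) (auto intro: inj_on_subset)
  moreover have "f ` P j \<subseteq> H" if "j \<in> J" for j using J(4)[OF that] assms(3) by blast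
  ultimately show ?thesis using J(1,2) unfolding unit_bundles_def by blast
qed

text \<open>The interval \<open>D = {l..q}\<close> consists of the worst of the \<open>q\<close> best goods, of which some bundle
  contains \<open>card D\<close> many. Exchanging these for \<open>D\<close> only improves the other bundles.\<close>

lemma unit_bundles_remove_interval_aux:
  assumes ub: "unit_bundles u v {1..m} n" and n: "n \<ge> 1"
    and l: "1 \<le> l" "l \<le> q" "q \<le> m" and big: "(q - l) * n < q"
    and anti: "\<And>g h. 1 \<le> g \<Longrightarrow> g \<le> h \<Longrightarrow> h \<le> m \<Longrightarrow> v h \<le> v g"
  shows "unit_bundles u v ({1..m} - {l..q}) (n - 1)"
proof -
  obtain J :: "nat set" and P where J: "finite J" "card J = n" "disjoint_family_on P J"
    "\<And>j. j \<in> J \<Longrightarrow> P j \<subseteq> {1..m}" "\<And>j. j \<in> J \<Longrightarrow> units u v (P j) 4"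
    using ub unfolding unit_bundles_def by blast
  obtain j0 where j0: "j0 \<in> J" using J(2) n by fastforce
  \<comment> \<open>The owner of a good. Goods in no bundle are counted for \<open>j0\<close>, so
    that the owner classes cover all of \<open>{1..q}\<close>; below it only matters that a good
    owned by \<open>j\<close> lies in no other bundle.\<close>
  define ow where "ow g = (if \<exists>k\<in>J. g \<in> P k then (SOME k. k \<in> J \<and> g \<in> P k) else j0)" for g
  have ow: "ow g \<in> J" for g
    using someI_ex[of "\<lambda>k. k \<in> J \<and> g \<in> P k"] j0 by (auto simp: ow_def)
  have ow_eq: "ow g = k" if "k \<in> J" "g \<in> P k" for g k
  proof -
    have "ow g \<in> J \<and> g \<in> P (ow g)"
      using someI_ex[of "\<lambda>k. k \<in> J \<and> g \<in> P k"] that by (auto simp: ow_def)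
    then show ?thesis using that J(3) by (auto simp: disjoint_family_on_def)
  qed
  \<comment> \<open>Pigeonhole: classes of size at most \<open>q - l\<close> would cover at most
    \<open>(q - l) * n < q\<close> goods.\<close>
  have "\<exists>j\<in>J. q - l < card {g \<in> {1..q}. ow g = j}"
  proof (rule ccontr)
    assume "\<not> ?thesis"
    then have small: "card {g \<in> {1..q}. ow g = j} \<le> q - l" if "j \<in> J" for j
      using that not_less by blast
    have "{1..q} = (\<Union>j\<in>J. {g \<in> {1..q}. ow g = j})" using ow by auto
    then have "card {1..q} \<le> (\<Sum>j\<in>J. card {g \<in> {1..q}. ow g = j})"
      using card_UN_le[OF J(1), of "\<lambda>j. {g \<in> {1..q}. ow g = j}"] by metis
    also have "\<dots> \<le> (\<Sum>j\<in>J. q - l)" by (intro sum_mono small)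
    finally show False using big J(2) by (simp add: mult.commute)
  qed
  then obtain j where j: "j \<in> J" "q - l < card {g \<in> {1..q}. ow g = j}" by blast
  then have "card {l..q} \<le> card {g \<in> {1..q}. ow g = j}" using l by auto
  then obtain C where C: "C \<subseteq> {g \<in> {1..q}. ow g = j}" "card C = card {l..q}" "finite C"
    by (rule obtain_subset_with_card_n)
  have "card ({l..q} - C) = card (C - {l..q})"
    using C(2,3) by (simp add: card_Diff_subset_Int Int_commute)
  then obtain s where s: "bij_betw s ({l..q} - C) (C - {l..q})"
    using C(3) finite_same_card_bij[of "{l..q} - C" "C - {l..q}"] by auto
  have CP: "C \<inter> P k = {}" if "k \<in> J" "k \<noteq> j" for k
    using C(1) ow_eq that by blast
  have sC: "s g \<in> C - {l..q}" if "g \<in> {l..q} - C" for g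
    using s that by (auto simp: bij_betw_def)
  define G where "G = (\<Union>k\<in>J - {j}. P k)"
  have GC: "C \<inter> G = {}" using CP by (auto simp: G_def)
  have Gm: "G \<subseteq> {1..m}" using J(4) by (auto simp: G_def)
  \<comment> \<open>Bundle \<open>j\<close> is given up, which frees \<open>C\<close>. In the other
    bundles, goods of the interval are replaced by goods of \<open>C\<close> outside it; these have
    indices below \<open>l\<close>.\<close>
  define f where "f g = (if g \<in> {l..q} then s g else g)" for g
  have "unit_bundles u v G (n - 1)"
    unfolding unit_bundles_def
  proof (intro exI conjI ballI)
    show "card (J - {j}) = n - 1" using J(1,2) j(1) by simp
    show "disjoint_family_on P (J - {j})" by (rule disjoint_family_on_mono[OF _ J(3)]) auto
  qed (use J in \<open>auto simp: G_def\<close>)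
  moreover have "inj_on f G"
  proof (rule inj_onI)
    fix x y assume xy: "x \<in> G" "y \<in> G" "f x = f y"
    \<comment> \<open>Membership of the image in \<open>C\<close> tells replaced goods from kept
      ones, so the two cases of \<open>f\<close> cannot collide.\<close>
    have mem: "f z \<in> C \<longleftrightarrow> z \<in> {l..q}" if "z \<in> G" for z
      using that GC sC[of z] by (auto simp: f_def)
    show "x = y"
    proof (cases "x \<in> {l..q}")
      case True
      then have "y \<in> {l..q}" using mem xy by metis
      then have "s x = s y" "x \<in> {l..q} - C" "y \<in> {l..q} - C" using True xy GC by (auto simp: f_def)
      then show ?thesis using s by (auto simp: bij_betw_def inj_on_def)
    next
      case False
      then have "y \<notin> {l..q}" using mem xy by metis
      then show ?thesis using False xy by (auto simp: f_def)
    qed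
  qed
  moreover have "f ` G \<subseteq> {1..m} - {l..q}"
  proof
    fix y assume "y \<in> f ` G"
    then obtain x where x: "x \<in> G" "y = f x" by blast
    show "y \<in> {1..m} - {l..q}"
    proof (cases "x \<in> {l..q}")
      case True
      then have "y \<in> C - {l..q}" using sC[of x] GC x by (auto simp: f_def)
      then show ?thesis using C(1) l(3) by auto
    next
      case False
      then show ?thesis using x Gm by (auto simp: f_def)
    qed
  qed
  moreover have "v g \<le> v (f g)" if "g \<in> G" for g
  proof (cases "g \<in> {l..q}")
    case True
    then have "s g \<in> C - {l..q}" using sC[of g] GC that by auto
    then have "1 \<le> s g" "s g < l" using C(1) by auto
    then show ?thesis using anti[of "s g" g] True l by (auto simp: f_def)
  qed (auto simp: f_def)
  ultimately show ?thesis by (rule unit_bundles_image)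
qed

lemma unit_bundles_drop:
  assumes "unit_bundles u v G n" "n \<ge> 1" "G \<subseteq> H"
  shows "unit_bundles u v H (n - 1)"
proof -
  obtain J :: "nat set" and P where J: "finite J" "card J = n" "disjoint_family_on P J"
    "\<And>j. j \<in> J \<Longrightarrow> P j \<subseteq> G" "\<And>j. j \<in> J \<Longrightarrow> units u v (P j) 4"
    using assms(1) unfolding unit_bundles_def by blast
  obtain j where j: "j \<in> J" using J(2) assms(2) by fastforce
  show ?thesis
    unfolding unit_bundles_def
  proof (intro exI conjI ballI)
    show "card (J - {j}) = n - 1" using J(1,2) j by simp
    show "disjoint_family_on P (J - {j})" by (rule disjoint_family_on_mono[OF _ J(3)]) auto
  qed (use J assms(3) in auto)
qed

text \<open>Goods beyond \<open>m\<close> do not exist, so the interval is cut off at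
  \<open>min h m\<close>. Hence \<open>big\<close> asks for every shorter length too: among the
  \<open>l + d\<close> best goods some one of \<open>n\<close> owners has more than
  \<open>d\<close>.\<close>

lemma unit_bundles_remove_interval:
  assumes ub: "unit_bundles u v {1..m} n" and n: "n \<ge> 1" and l: "1 \<le> l" "l \<le> h"
    and big: "\<And>d. d \<le> h - l \<Longrightarrow> d * n < l + d"
    and anti: "\<And>g h. 1 \<le> g \<Longrightarrow> g \<le> h \<Longrightarrow> h \<le> m \<Longrightarrow> v h \<le> v g"
  shows "unit_bundles u v ({1..m} - {l..h}) (n - 1)"
proof (cases "l \<le> m")
  case True
  have "(min h m - l) * n < min h m" using big[of "min h m - l"] True l by auto
  then have "unit_bundles u v ({1..m} - {l..min h m}) (n - 1)"
    using True l by (intro unit_bundles_remove_interval_aux[OF ub n _ _ _ _ anti]) auto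
  moreover have "{1..m} - {l..min h m} = {1..m} - {l..h}" by auto
  ultimately show ?thesis by simp
next
  case False
  then show ?thesis by (intro unit_bundles_drop[OF ub n]) auto
qed

text \<open>If both goods belong to one bundle, that bundle is given up. Otherwise the remainders of
  the two bundles keep one and three units and are merged.\<close>

lemma unit_bundles_remove_pair:
  assumes ub: "unit_bundles u v G n" and n: "n \<ge> 1" and u: "u \<le> 1"
    and x: "0 \<le> v x" "v x \<le> 1 - u" and y: "0 \<le> v y" "v y \<le> (1 - u) / 3"
  shows "unit_bundles u v (G - {x, y}) (n - 1)"
proof -
  obtain J :: "nat set" and P where J: "finite J" "card J = n" "disjoint_family_on P J"
    "\<And>j. j \<in> J \<Longrightarrow> P j \<subseteq> G" "\<And>j. j \<in> J \<Longrightarrow> units u v (P j) 4"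
    using ub unfolding unit_bundles_def by blast
  have disj: "P j \<inter> P k = {}" if "j \<in> J" "k \<in> J" "j \<noteq> k" for j k
    using J(3) that by (auto simp: disjoint_family_on_def)
  \<comment> \<open>A good outside all bundles is assigned an arbitrary owner.\<close>
  have owner: "\<exists>j\<in>J. \<forall>k\<in>J - {j}. z \<notin> P k" for z
  proof (cases "\<exists>j\<in>J. z \<in> P j")
    case True
    then show ?thesis using disj by blast
  next
    case False
    moreover obtain j where "j \<in> J" using J(2) n by fastforce
    ultimately show ?thesis by blast
  qed
  obtain j where j: "j \<in> J" "\<And>l. l \<in> J \<Longrightarrow> l \<noteq> j \<Longrightarrow> x \<notin> P l" using owner[of x] by blast
  obtain k where k: "k \<in> J" "\<And>l. l \<in> J \<Longrightarrow> l \<noteq> k \<Longrightarrow> y \<notin> P l" using owner[of y] by blast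
  have card: "card (J - {j}) = n - 1" using J(1,2) j by simp
  show ?thesis
  proof (cases "j = k")
    case True
    have "P l \<subseteq> G - {x, y} \<and> units u v (P l) 4" if "l \<in> J - {j}" for l
      using that J(4)[of l] J(5)[of l] j(2)[of l] k(2)[of l] True by auto
    moreover have "disjoint_family_on P (J - {j})" by (rule disjoint_family_on_mono[OF _ J(3)]) auto
    ultimately show ?thesis using J(1) card unfolding unit_bundles_def by blast
  next
    case False
    \<comment> \<open>The merged bundle takes index \<open>k\<close>, and index \<open>j\<close> is
      dropped.\<close>
    define Q where "Q = P(k := (P j - {x}) \<union> (P k - {y}))"
    have "units u v (P j - {x}) (4 - 3)" "units u v (P k - {y}) (4 - 1)"
      using units_remove_large[OF J(5)[OF j(1)] x u] units_remove_small[OF J(5)[OF k(1)] y u] by auto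
    then have "units u v ((P j - {x}) \<union> (P k - {y})) ((4 - 3) + (4 - 1))"
      using disj[OF j(1) k(1) False] by (intro units.union) auto
    then have Qk: "units u v (Q k) 4" by (simp add: Q_def)
    have "Q l \<subseteq> G - {x, y} \<and> units u v (Q l) 4" if l: "l \<in> J - {j}" for l
    proof (cases "l = k")
      case True
      have "Q k \<subseteq> G - {x, y}"
        using J(4)[OF j(1)] J(4)[OF k(1)] j(2)[OF k(1)] k(2)[OF j(1)] False by (auto simp: Q_def)
      then show ?thesis using Qk True by simp
    next
      case False
      then show ?thesis using l J(4)[of l] J(5)[of l] j(2)[of l] k(2)[of l] by (auto simp: Q_def)
    qed
    moreover have "disjoint_family_on Q (J - {j})"
      unfolding disjoint_family_on_def
    proof (intro ballI impI)
      fix a b assume ab: "a \<in> J - {j}" "b \<in> J - {j}" "a \<noteq> b"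
      then have "P a \<inter> P b = {}" "P a \<inter> P j = {}" "P b \<inter> P j = {}" using disj j(1) by auto
      then show "Q a \<inter> Q b = {}" using ab(3) by (auto simp: Q_def)
    qed
    ultimately show ?thesis using J(1) card unfolding unit_bundles_def by blast
  qed
qed

section \<open>The reduction\<close>

text \<open>The re-indexing inside \<open>remove_goods\<close>, as a map from new to old indices
  that is common to all agents.\<close>

definition survivor :: "nat \<Rightarrow> nat set \<Rightarrow> nat \<Rightarrow> nat" where
  "survivor m S j = sorted_list_of_set ({1..m} - S) ! (j - 1)"

lemma remove_goods_eq: "remove_goods m S v i j = v i (survivor m S j)"
  by (simp add: remove_goods_def survivor_def)

lemma card_survivors: "card ({1..m} - S) = m - card (S \<inter> {1..m})"
  by (simp add: card_Diff_subset_Int Int_commute)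

lemma survivor_bij: "bij_betw (survivor m S) {1..m - card (S \<inter> {1..m})} ({1..m} - S)"
proof -
  define L where "L = sorted_list_of_set ({1..m} - S)"
  have len: "length L = m - card (S \<inter> {1..m})"
    unfolding L_def by (simp only: length_sorted_list_of_set card_survivors)
  have "bij_betw (\<lambda>j. j - 1) {1..m - card (S \<inter> {1..m})} {..<length L}"
    by (rule bij_betw_byWitness[where f' = Suc]) (auto simp: len)
  moreover have "bij_betw ((!) L) {..<length L} ({1..m} - S)"
    by (rule bij_betw_nth) (auto simp: L_def)
  ultimately have "bij_betw ((!) L \<circ> (\<lambda>j. j - 1)) {1..m - card (S \<inter> {1..m})} ({1..m} - S)"
    by (rule bij_betw_trans)
  moreover have "(!) L \<circ> (\<lambda>j. j - 1) = survivor m S" by (auto simp: survivor_def L_def)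
  ultimately show ?thesis by simp
qed

lemma survivor_mono:
  assumes "1 \<le> g" "g \<le> h" "h \<le> m - card (S \<inter> {1..m})"
  shows "survivor m S g \<le> survivor m S h"
  unfolding survivor_def using assms
  by (intro sorted_nth_mono)
    (auto simp only: length_sorted_list_of_set card_survivors sorted_sorted_list_of_set)

lemma survivor_mem:
  "j \<in> {1..m - card (S \<inter> {1..m})} \<Longrightarrow> survivor m S j \<in> {1..m} - S"
  by (rule bij_betwE[OF survivor_bij, rule_format])

lemma ordered_remove_goods:
  assumes "ordered N {1..m} v"
  shows "ordered N {1..m - card (S \<inter> {1..m})} (remove_goods m S v)"
  unfolding ordered_interval_iff remove_goods_eq
proof (intro ballI allI impI)
  fix i g h assume i: "i \<in> N" and gh: "1 \<le> g \<and> g \<le> h \<and> h \<le> m - card (S \<inter> {1..m})"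
  have "survivor m S g \<le> survivor m S h" using gh survivor_mono by blast
  moreover have "survivor m S g \<in> {1..m} - S" "survivor m S h \<in> {1..m} - S"
    using gh survivor_mem[of g m S] survivor_mem[of h m S] by auto
  ultimately show "v i (survivor m S h) \<le> v i (survivor m S g)"
    using assms i unfolding ordered_interval_iff by auto
qed

lemma unit_bundles_remove_goods:
  assumes "unit_bundles u (v i) ({1..m} - S) n"
  shows "unit_bundles u (remove_goods m S v i) {1..m - card (S \<inter> {1..m})} n"
proof -
  let ?f = "the_inv_into {1..m - card (S \<inter> {1..m})} (survivor m S)"
  have f: "bij_betw ?f ({1..m} - S) {1..m - card (S \<inter> {1..m})}"
    by (rule bij_betw_the_inv_into[OF survivor_bij])
  have "v i g \<le> remove_goods m S v i (?f g)" if "g \<in> {1..m} - S" for g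
    using f_the_inv_into_f_bij_betw[OF survivor_bij[of m S], of g] that by (simp add: remove_goods_eq)
  then show ?thesis using f by (intro unit_bundles_image[OF assms]) (auto simp: bij_betw_def)
qed

text \<open>Here \<open>i\<close> is any agent, not just the one served by the rule. This suffices
  because a smaller rule that is not applicable fails its threshold for every agent.\<close>

lemma rule_preserves_unit_bundles:
  assumes k: "k \<in> {1..4}" and smaller: "\<forall>k'\<in>{1..<k}. \<not> applicable (1 - u) N m v k'"
    and i: "i \<in> N" and N: "finite N" and u: "u \<le> 1"
    and ord: "ordered N {1..m} v" and nonneg: "\<And>g. g \<in> {1..m} \<Longrightarrow> 0 \<le> v i g"
    and ub: "unit_bundles u (v i) {1..m} (card N)"
  shows "unit_bundles u (v i) ({1..m} - rset k (card N)) (card N - 1)"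
proof -
  define n where "n = card N"
  have n: "n \<ge> 1" using i N by (auto simp: n_def Suc_le_eq card_gt_0_iff)
  have anti: "v i h \<le> v i g" if "1 \<le> g" "g \<le> h" "h \<le> m" for g h
    using ord i that unfolding ordered_interval_iff by blast
  have ub': "unit_bundles u (v i) {1..m} n" using ub by (simp add: n_def)
  have remove: "unit_bundles u (v i) ({1..m} - {l..h}) (n - 1)"
    if "1 \<le> l" "l \<le> h" "\<And>d. d \<le> h - l \<Longrightarrow> d * n < l + d" for l h
    by (rule unit_bundles_remove_interval[OF ub' n that anti])
  consider "k = 1" | "k = 2" | "k = 3" | "k = 4" using k by force
  then have "unit_bundles u (v i) ({1..m} - rset k n) (n - 1)"
  proof cases
    case 1
    have "rset k n = {1..1}" using 1 by (auto simp: rset_def)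
    then show ?thesis using remove[of 1 1] by simp
  next
    case 2
    have "rset k n = {2*n - 1..2*n + 1}" using 2 n by (auto simp: rset_def)
    \<comment> \<open>For \<open>d = 2\<close> all three goods exist, and of the
      \<open>2*n + 1\<close> best goods some owner has three.\<close>
    moreover have "d * n < (2*n - 1) + d" if "d \<le> (2*n + 1) - (2*n - 1)" for d
    proof -
      have "d = 0 \<or> d = 1 \<or> d = 2" using that n by linarith
      then show ?thesis using n by auto
    qed
    ultimately show ?thesis using remove[of "2*n - 1" "2*n + 1"] n by auto
  next
    case 3
    have "rset k n = {3*n - 2..3*n + 1}" using 3 by (auto simp: rset_def)
    \<comment> \<open>For \<open>d = 3\<close> all four goods exist, and of the
      \<open>3*n + 1\<close> best goods some owner has four.\<close>
    moreover have "d * n < (3*n - 2) + d" if "d \<le> (3*n + 1) - (3*n - 2)" for d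
    proof -
      have "d = 0 \<or> d = 1 \<or> d = 2 \<or> d = 3" using that n by linarith
      then show ?thesis using n by auto
    qed
    ultimately show ?thesis using remove[of "3*n - 2" "3*n + 1"] n by auto
  next
    case 4
    have S: "rset k n = {1, 2*n + 1}" using 4 by (auto simp: rset_def)
    show ?thesis
    \<comment> \<open>If good \<open>2*n + 1\<close> does not exist, \<open>R_4\<close> removes at
      most good \<open>1\<close> and acts on the bundles like \<open>R_1\<close>.\<close>
    proof (cases "2*n + 1 \<le> m")
      case True
      have less: "sum (v i) (rset k' n \<inter> {1..m}) < 1 - u" if "k' \<in> {1, 2}" for k'
        using smaller i 4 that unfolding applicable_def n_def by (auto simp: not_le)
      have "rset 1 n \<inter> {1..m} = {1}" using True by (auto simp: rset_def)
      then have v1: "v i 1 < 1 - u" using less[of 1] by simp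
      have distinct: "2*n - 1 \<noteq> 2*n" "2*n - 1 \<noteq> 2*n + 1" "2*n \<noteq> 2*n + 1" using n by auto
      have "rset 2 n \<inter> {1..m} = {2*n - 1, 2*n, 2*n + 1}" using True n by (auto simp: rset_def)
      then have "v i (2*n - 1) + (v i (2*n) + v i (2*n + 1)) < 1 - u"
        using less[of 2] distinct by (simp del: One_nat_def)
      moreover have "v i (2*n + 1) \<le> v i (2*n - 1)" "v i (2*n + 1) \<le> v i (2*n)"
        using True n by (auto intro!: anti)
      \<comment> \<open>Good \<open>2*n + 1\<close> is the least valuable of the three goods of
        \<open>R_2\<close>, which together stay below \<open>1 - u\<close>.\<close>
      ultimately have "v i (2*n + 1) \<le> (1 - u) / 3" by simp
      then show ?thesis
        unfolding S using v1 True by (intro unit_bundles_remove_pair[OF ub' n u]) (auto intro: nonneg)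
    next
      case False
      then have "{1..m} - rset k n = {1..m} - {1..1}" by (auto simp: S)
      then show ?thesis using remove[of 1 1] by simp
    qed
  qed
  then show ?thesis by (simp add: n_def)
qed

text \<open>Each rule costs one agent and one bundle, so the counts stay equal along the run.
  Irreducibility comes from the condition under which the run stops.\<close>

lemma reduce_run_invariant:
  assumes "reduce_run (1 - u) N m v N' m' v'" "u \<le> 1"
    and "finite N" "ordered N {1..m} v" "\<And>i g. i \<in> N \<Longrightarrow> g \<in> {1..m} \<Longrightarrow> 0 \<le> v i g"
    and "\<And>i. i \<in> N \<Longrightarrow> unit_bundles u (v i) {1..m} (card N)"
  shows "finite N' \<and> ordered N' {1..m'} v' \<and> (\<forall>i\<in>N'. \<forall>g\<in>{1..m'}. 0 \<le> v' i g) \<and>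
    (\<forall>i\<in>N'. unit_bundles u (v' i) {1..m'} (card N')) \<and> irreducible (1 - u) N' {1..m'} v'"
  using assms
proof (induction rule: reduce_run.induct)
  case (stop N m v)
  then show ?case by (auto simp: irreducible_def)
next
  case (step k N m v i N' m' v')
  let ?S = "rset k (card N)"
  show ?case
  proof (rule step.IH)
    show "ordered (N - {i}) {1..m - card (?S \<inter> {1..m})} (remove_goods m ?S v)"
      using ordered_remove_goods[OF step.prems(3)] unfolding ordered_interval_iff by blast
  next
    fix j g assume j: "j \<in> N - {i}" and g: "g \<in> {1..m - card (?S \<inter> {1..m})}"
    show "0 \<le> remove_goods m ?S v j g"
      unfolding remove_goods_eq using step.prems(4)[of j] survivor_mem[OF g] j by blast
  next
    fix j assume j: "j \<in> N - {i}"
    have "unit_bundles u (v j) ({1..m} - ?S) (card N - 1)"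
      using j step.prems step.hyps by (intro rule_preserves_unit_bundles) auto
    then show "unit_bundles u (remove_goods m ?S v j) {1..m - card (?S \<inter> {1..m})} (card (N - {i}))"
      using unit_bundles_remove_goods step.hyps step.prems(2) by (metis card_Diff_singleton)
  qed (use step.prems in auto)
qed

text \<open>The bound \<open>\<beta>\<close> is an absolute value, not a multiple of a maximin
  share, so it carries over between the instances of the run unchanged. Removed agents already hold
  a set worth \<open>\<alpha> \<ge> \<beta>\<close>.\<close>

lemma reduce_run_allocation:
  assumes "reduce_run \<alpha> N m v N' m' v'" "\<beta> \<le> \<alpha>"
    and "is_allocation N' {1..m'} A" "\<And>i. i \<in> N' \<Longrightarrow> \<beta> \<le> sum (v' i) (A i)"
  shows "\<exists>B. is_allocation N {1..m} B \<and> (\<forall>i\<in>N. \<beta> \<le> sum (v i) (B i))"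
  using assms
proof (induction rule: reduce_run.induct)
  case (stop N m v)
  then show ?case by blast
next
  case (step k N m v i N' m' v')
  let ?S = "rset k (card N)" and ?m = "m - card (rset k (card N) \<inter> {1..m})"
  let ?f = "survivor m ?S"
  obtain B where B: "is_allocation (N - {i}) {1..?m} B"
    "\<And>j. j \<in> N - {i} \<Longrightarrow> \<beta> \<le> sum (remove_goods m ?S v j) (B j)"
    using step.IH[OF step.prems] by blast
  have f: "inj_on ?f {1..?m}" "?f ` {1..?m} \<subseteq> {1..m} - ?S"
    using survivor_bij[of m ?S] by (auto simp: bij_betw_def)
  have alloc: "is_allocation (N - {i}) ({1..m} - ?S) (\<lambda>j. ?f ` B j)"
    by (rule is_allocation_image[OF B(1) f])
  define C where "C = (\<lambda>j. ?f ` B j)(i := ?S \<inter> {1..m})"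
  have "is_allocation N {1..m} C"
    unfolding is_allocation_def
  proof (intro conjI ballI impI)
    fix j assume "j \<in> N" then show "C j \<subseteq> {1..m}"
      using alloc by (cases "j = i") (auto simp: C_def is_allocation_def)
  next
    fix j k assume jk: "j \<in> N" "k \<in> N" "j \<noteq> k"
    have sub: "?f ` B l \<subseteq> {1..m} - ?S" if "l \<in> N - {i}" for l
      using alloc that by (auto simp: is_allocation_def)
    consider "j = i" | "k = i" | "j \<in> N - {i}" "k \<in> N - {i}" using jk by blast
    then show "C j \<inter> C k = {}"
    proof cases
      case 1
      then show ?thesis using sub[of k] jk by (auto simp: C_def)
    next
      case 2
      then show ?thesis using sub[of j] jk by (auto simp: C_def)
    next
      case 3
      then show ?thesis using alloc jk(3) by (auto simp: C_def is_allocation_def)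
    qed
  qed
  moreover have "\<beta> \<le> sum (v j) (C j)" if j: "j \<in> N" for j
  proof (cases "j = i")
    case True
    then show ?thesis using step.hyps step.prems(1) by (simp add: C_def)
  next
    case False
    have "inj_on ?f (B j)"
      using B(1) f(1) j False by (auto simp: is_allocation_def intro: inj_on_subset)
    then have "sum (v j) (?f ` B j) = sum (remove_goods m ?S v j) (B j)"
      by (simp add: sum.reindex remove_goods_eq)
    then show ?thesis using B(2)[of j] j False by (simp add: C_def)
  qed
  ultimately show ?case by blast
qed

section \<open>Normalization\<close>

lemma mms_order_val:
  assumes "finite M" "d > 0"
  shows "mms d (order_val v M i) {1..card M} = mms d (v i) M"
proof -
  obtain s where s: "bij_betw s {1..card M} M"
    "\<And>j. j \<in> {1..card M} \<Longrightarrow> order_val v M i j = v i (s j)"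
    by (rule order_val_bij[OF assms(1), of v i]) blast
  show ?thesis using s(1) _ assms(2) s(2) by (rule mms_bij) simp
qed

text \<open>Bundles of equal value survive sorting, since for a single agent it only renames the
  goods.\<close>

lemma order_val_equal_bundles:
  assumes "finite M" "is_part d M P" "\<And>j. j < d \<Longrightarrow> sum (v i) (P j) = c"
  obtains Q where "is_part d {1..card M} Q" "\<And>j. j < d \<Longrightarrow> sum (order_val v M i) (Q j) = c"
proof -
  obtain s where s: "bij_betw s {1..card M} M"
    "\<And>j. j \<in> {1..card M} \<Longrightarrow> order_val v M i j = v i (s j)"
    by (rule order_val_bij[OF assms(1), of v i]) blast
  let ?t = "the_inv_into {1..card M} s"
  have t: "bij_betw ?t M {1..card M}" by (rule bij_betw_the_inv_into[OF s(1)])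
  have vt: "v i x = order_val v M i (?t x)" if "x \<in> M" for x
  proof -
    have "order_val v M i (?t x) = v i (s (?t x))"
      by (rule s(2)) (use t that in \<open>auto simp: bij_betw_def\<close>)
    then show ?thesis using f_the_inv_into_f_bij_betw[OF s(1), of x] that by simp
  qed
  show ?thesis
  proof (rule that[OF is_part_image[OF t assms(2)]])
    fix j assume j: "j < d"
    have "sum (order_val v M i) (?t ` P j) = sum (v i) (P j)"
      by (rule sum_bij_image[OF t is_part_subset[OF assms(2) j]]) (rule vt)
    then show "sum (order_val v M i) (?t ` P j) = c" using assms(3)[OF j] by simp
  qed
qed

lemma is_mms_partition_if_equal_bundles:
  assumes "finite S" "d > 0" "is_part d S P" "\<And>j. j < d \<Longrightarrow> sum v (P j) = c"
  shows "is_mms_partition d v S P"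
proof -
  have "(\<lambda>j. sum v (P j)) ` {..<d} = {c}" using assms(2,4) by auto
  then show ?thesis
    using assms(3) mms_eq_if_equal_bundles[OF assms] by (simp add: is_mms_partition_def min_bundle_def)
qed

text \<open>Each bundle of the chosen partition is worth at least \<open>c > 0\<close>. So dividing
  by its value is legitimate, makes it worth exactly \<open>1\<close>, and raises no good by more
  than the factor \<open>1 / c\<close>.\<close>

lemma is_normalization_bundles:
  assumes "is_normalization N M v v'" "finite N" "finite M" "i \<in> N" "0 < c" "c \<le> mms (card N) (v i) M"
    and nonneg: "\<And>g. g \<in> M \<Longrightarrow> 0 \<le> v i g"
  obtains P where "is_part (card N) M P" "\<And>j. j < card N \<Longrightarrow> sum (v' i) (P j) = 1"
    "\<And>g. g \<in> M \<Longrightarrow> c * v' i g \<le> v i g"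
proof -
  have n: "card N > 0" using assms(2,4) by (auto simp: card_gt_0_iff)
  obtain P where P: "is_part (card N) M P" "min_bundle (card N) (v i) P = mms (card N) (v i) M"
    "\<And>j g. j < card N \<Longrightarrow> g \<in> P j \<Longrightarrow> v' i g = v i g / sum (v i) (P j)"
    using assms(1,4) unfolding is_normalization_def is_mms_partition_def by blast
  have ge: "c \<le> sum (v i) (P j)" if "j < card N" for j
    using le_min_bundle_iff[OF n, of c "v i" P] P(2) assms(6) that by simp
  show ?thesis
  proof (rule that[OF P(1)])
    fix j assume j: "j < card N"
    have "sum (v' i) (P j) = (\<Sum>g\<in>P j. v i g / sum (v i) (P j))"
      by (rule sum.cong[OF refl]) (rule P(3)[OF j])
    also have "\<dots> = sum (v i) (P j) / sum (v i) (P j)" by (rule sum_divide_distrib[symmetric])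
    finally show "sum (v' i) (P j) = 1" using ge[OF j] assms(5) by simp
  next
    fix g assume g: "g \<in> M"
    then obtain j where j: "j < card N" "g \<in> P j" using P(1) by (auto simp: is_part_def)
    have "c * v i g \<le> sum (v i) (P j) * v i g" by (rule mult_right_mono[OF ge[OF j(1)] nonneg[OF g]])
    then have "c * v i g / sum (v i) (P j) \<le> v i g"
      using ge[OF j(1)] assms(5) by (simp add: pos_divide_le_eq mult.commute)
    then show "c * v' i g \<le> v i g" using P(3)[OF j] by simp
  qed
qed

section \<open>Assembly: the three constructions and the way back\<close>

theorem theorem14:
  fixes N :: "'a set" and M :: "'g set" and v :: "'a \<Rightarrow> 'g \<Rightarrow> real" and \<epsilon> :: real
    and N' :: "'a set" and m' :: nat and vr vn :: "'a \<Rightarrow> nat \<Rightarrow> real"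
  assumes "finite N" and "finite M"
    and "\<forall>i\<in>N. \<forall>g\<in>M. v i g \<ge> 0"
    and "\<forall>i\<in>N. mms (card N) (v i) M > 0"
    and "0 \<le> \<epsilon>" and "\<epsilon> < 1/4"
    and "reduce_rel \<epsilon> N M v N' m' vr"
    and "is_normalization N' {1..m'} vr vn"
  shows "ONI (4*\<epsilon> / (1 - 4*\<epsilon>)) N' {1..m'} (order_val vn {1..m'}) \<and>
         (\<forall>\<alpha>::real. (\<exists>A. is_mms_alloc \<alpha> N' {1..m'} (order_val vn {1..m'}) A) \<longrightarrow>
            (\<exists>B. is_mms_alloc (min (3/4 + \<epsilon>) ((1 - 4*\<epsilon>) * \<alpha>)) N M v B))"
proof -
  define u where "u = 1/4 - \<epsilon>"
  have u: "0 < u" "u \<le> 1/4" "1 - u = 3/4 + \<epsilon>" "4 * u = 1 - 4*\<epsilon>" using assms(5,6) by (auto simp: u_def)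
  define v1 where "v1 = order_val v M"
  define v2 where "v2 i g = v1 i g / mms (card N) (v i) M" for i g
  have n: "card N > 0" if "i \<in> N" for i using that assms(1) by (auto simp: card_gt_0_iff)
  have mms1: "mms (card N) (v1 i) {1..card M} = mms (card N) (v i) M" if "i \<in> N" for i
    unfolding v1_def by (rule mms_order_val[OF assms(2) n[OF that]])
  have pos: "mms (card N) (v i) M > 0" if "i \<in> N" for i using assms(4) that by blast

  have v1_nonneg: "0 \<le> v1 i g" if "i \<in> N" "g \<in> {1..card M}" for i g
  proof -
    obtain s where s: "bij_betw s {1..card M} M"
      "\<And>j. j \<in> {1..card M} \<Longrightarrow> order_val v M i j = v i (s j)"
      by (rule order_val_bij[OF assms(2), of v i]) blast
    have "s g \<in> M" using s(1) that(2) by (auto simp: bij_betw_def)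
    then show ?thesis using s(2)[OF that(2)] assms(3) that(1) by (simp add: v1_def)
  qed
  have ord2: "ordered N {1..card M} v2"
    using ordered_order_val[of N M v] pos unfolding ordered_interval_iff v2_def v1_def
    by (auto intro!: divide_right_mono intro: less_imp_le)
  have nonneg2: "0 \<le> v2 i g" if "i \<in> N" "g \<in> {1..card M}" for i g
    using v1_nonneg[OF that] pos[OF that(1)] by (simp add: v2_def)
  \<comment> \<open>The invariant holds at the start: after scaling, each bundle of a maximin
    partition is worth at least \<open>1\<close>, which is level \<open>4\<close>.\<close>
  have ub2: "unit_bundles u (v2 i) {1..card M} (card N)" if i: "i \<in> N" for i
  proof -
    obtain P where P: "is_part (card N) {1..card M} P"
      "\<forall>j<card N. mms (card N) (v i) M \<le> sum (v1 i) (P j)"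
      using le_mms_iff[of "{1..card M}" "card N" "mms (card N) (v i) M" "v1 i"] n[OF i] mms1[OF i]
      by auto
    have "units u (v2 i) (P j) 4" if j: "j < card N" for j
    proof (rule units.level)
      show "finite (P j)" using is_part_subset[OF P(1) j] finite_subset by blast
      have "sum (v2 i) (P j) = sum (v1 i) (P j) / mms (card N) (v i) M"
        by (simp add: v2_def sum_divide_distrib)
      then have "1 \<le> sum (v2 i) (P j)" using P(2) j pos[OF i] by simp
      then show "u + (real 4 - 1) * ((1 - u) / 3) \<le> sum (v2 i) (P j)" by (simp add: field_simps)
    qed simp
    then show ?thesis
      unfolding unit_bundles_def using P(1)
      by (intro exI[of _ "{..<card N}"] exI[of _ P]) (auto simp: is_part_def disjoint_family_on_def)
  qed

  \<comment> \<open>The scaling literally as in \<open>reduce_rel\<close>; it is shown to agree with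
    \<open>v2\<close> for agents in \<open>N\<close>.\<close>
  let ?v2' = "\<lambda>i g. v1 i g / mms (card N) (v1 i) {1..card M}"
  have v2'_eq: "?v2' i = v2 i" if "i \<in> N" for i
    unfolding mms1[OF that] by (simp add: v2_def fun_eq_iff)
  have run: "reduce_run (1 - u) N (card M) ?v2' N' m' vr"
    using assms(7) unfolding reduce_rel_def Let_def u(3) v1_def .
  have "finite N' \<and> ordered N' {1..m'} vr \<and> (\<forall>i\<in>N'. \<forall>g\<in>{1..m'}. 0 \<le> vr i g) \<and>
    (\<forall>i\<in>N'. unit_bundles u (vr i) {1..m'} (card N')) \<and> irreducible (1 - u) N' {1..m'} vr"
  proof (rule reduce_run_invariant[OF run _ assms(1)])
    show "ordered N {1..card M} ?v2'"
      using ord2 v2'_eq unfolding ordered_interval_iff by metis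
    show "0 \<le> ?v2' i g" if "i \<in> N" "g \<in> {1..card M}" for i g
      using nonneg2[OF that] v2'_eq[OF that(1)] by metis
    show "unit_bundles u (?v2' i) {1..card M} (card N)" if "i \<in> N" for i
      using ub2[OF that] v2'_eq[OF that] by simp
  qed (use u in auto)
  then have N': "finite N'" and ord_r: "ordered N' {1..m'} vr"
    and nonneg_r: "\<And>i g. i \<in> N' \<Longrightarrow> g \<in> {1..m'} \<Longrightarrow> 0 \<le> vr i g"
    and ub_r: "\<And>i. i \<in> N' \<Longrightarrow> unit_bundles u (vr i) {1..m'} (card N')"
    and irr_r: "irreducible (1 - u) N' {1..m'} vr" by blast+
  have n': "card N' > 0" if "i \<in> N'" for i using that N' by (auto simp: card_gt_0_iff)
  have mms_r: "4 * u \<le> mms (card N') (vr i) {1..m'}" if "i \<in> N'" for i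
    using ub_r[OF that] n'[OF that] u(2) nonneg_r[OF that] by (intro unit_bundles_mms) auto

  define w where "w = order_val vn {1..m'}"
  have norm: "(\<exists>Q. is_part (card N') {1..m'} Q \<and> (\<forall>j<card N'. sum (w i) (Q j) = 1)) \<and>
      (\<forall>g\<in>{1..m'}. 4 * u * vn i g \<le> vr i g)" if i: "i \<in> N'" for i
  proof -
    obtain P where P: "is_part (card N') {1..m'} P" "\<And>j. j < card N' \<Longrightarrow> sum (vn i) (P j) = 1"
      "\<And>g. g \<in> {1..m'} \<Longrightarrow> 4 * u * vn i g \<le> vr i g"
      by (rule is_normalization_bundles[OF assms(8) N' _ i _ mms_r[OF i] nonneg_r[OF i]])
        (use u(1) in simp_all)
    obtain Q where "is_part (card N') {1..card {1..m'}} Q"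
      "\<And>j. j < card N' \<Longrightarrow> sum (order_val vn {1..m'} i) (Q j) = 1"
      by (rule order_val_equal_bundles[OF _ P(1), of vn i 1]) (use P(2) in auto)
    then show ?thesis using P(3) by (auto simp: w_def)
  qed
  have mms_w: "mms (card N') (w i) {1..m'} = 1" if "i \<in> N'" for i
    using norm[OF that] mms_eq_if_equal_bundles[of "{1..m'}" "card N'" _ "w i" 1] n'[OF that] by blast

  have "ordered N' {1..m'} w" using ordered_order_val[of N' "{1..m'}" vn] by (simp add: w_def)
  moreover have "normalized N' {1..m'} w"
    unfolding normalized_def
  proof
    fix i assume i: "i \<in> N'"
    obtain Q where Q: "is_part (card N') {1..m'} Q" "\<forall>j<card N'. sum (w i) (Q j) = 1"
      using norm[OF i] by blast
    have "is_mms_partition (card N') (w i) {1..m'} Q"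
      by (rule is_mms_partition_if_equal_bundles[OF _ n'[OF i] Q(1)]) (use Q(2) in auto)
    then show "\<exists>P. is_mms_partition (card N') (w i) {1..m'} P \<and> (\<forall>j<card N'. sum (w i) (P j) = 1)"
      using Q(2) by blast
  qed
  moreover have "irreducible (3/4 + 4*\<epsilon> / (1 - 4*\<epsilon>)) N' {1..m'} w"
    unfolding irreducible_def applicable_def
  proof (intro ballI notI, elim bexE)
    fix k i assume k: "k \<in> {1..4::nat}" and i: "i \<in> N'"
    let ?S = "rset k (card N') \<inter> {1..card {1..m'}}"
    assume ge: "3/4 + 4*\<epsilon> / (1 - 4*\<epsilon>) \<le> sum (w i) ?S"
    \<comment> \<open>Normalizing gives this bound for \<open>vn\<close>; sorting preserves it
      because \<open>vr\<close> is already ordered.\<close>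
    have "w i g \<le> vr i g / (4 * u)" if "g \<in> {1..m'}" for g
      unfolding w_def
    proof (rule order_val_le[where w = vn and c = "\<lambda>g. vr i g / (4 * u)"])
      show "vn i h \<le> vr i h / (4 * u)" if "h \<in> {1..m'}" for h
        using norm[OF i] that u(1) by (simp add: pos_le_divide_eq mult.commute)
      show "vr i h / (4 * u) \<le> vr i g / (4 * u)" if "1 \<le> g" "g \<le> h" "h \<le> m'" for g h
        using ord_r i that u(1) unfolding ordered_interval_iff by (intro divide_right_mono) auto
    qed (rule that)
    then have "sum (w i) ?S \<le> (\<Sum>g\<in>?S. vr i g / (4 * u))" by (intro sum_mono) auto
    also have "\<dots> = sum (vr i) ?S / (4 * u)" by (simp add: sum_divide_distrib)
    also have "\<dots> < (1 - u) / (4 * u)"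
      using irr_r k i u(1) unfolding irreducible_def applicable_def
      by (intro divide_strict_right_mono) (auto simp: not_le)
    \<comment> \<open>With \<open>u = 1/4 - \<epsilon>\<close> the quotient is
      \<open>(3/4 + \<epsilon>) / (1 - 4*\<epsilon>)\<close>, and
      \<open>3/4 * (1 - 4*\<epsilon>) + 4*\<epsilon> = 3/4 + \<epsilon>\<close>.\<close>
    also have "\<dots> = 3/4 + 4*\<epsilon> / (1 - 4*\<epsilon>)"
      using u assms(6) by (simp add: field_simps)
    finally show False using ge by simp
  qed
  ultimately have "ONI (4*\<epsilon> / (1 - 4*\<epsilon>)) N' {1..m'} w" by (simp add: ONI_def)
  moreover have "\<exists>B. is_mms_alloc (min (3/4 + \<epsilon>) ((1 - 4*\<epsilon>) * \<alpha>)) N M v B"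
    if A: "is_mms_alloc \<alpha> N' {1..m'} w A" for \<alpha> A
  proof -
    define \<beta> where "\<beta> = min (3/4 + \<epsilon>) ((1 - 4*\<epsilon>) * \<alpha>)"
    have allocA: "is_allocation N' {1..card {1..m'}} A" using A by (simp add: is_mms_alloc_def)
    have A_ge: "\<alpha> \<le> sum (w i) (A i)" if "i \<in> N'" for i
    proof -
      have "\<alpha> * mms (card N') (w i) {1..m'} \<le> sum (w i) (A i)"
        using A that by (simp add: is_mms_alloc_def)
      then show ?thesis unfolding mms_w[OF that] by simp
    qed
    \<comment> \<open>The constructions are undone in reverse order: \<open>B\<close> undoes the
      last sorting and is valued by \<open>vr\<close>, \<open>C\<close> undoes the reduction, and
      \<open>D\<close> undoes the first sorting.\<close>
    obtain B where B: "is_allocation N' {1..m'} B"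
      "\<And>i. i \<in> N' \<Longrightarrow> sum (w i) (A i) \<le> sum (vn i) (B i)"
      unfolding w_def by (rule unorder_allocation[OF _ allocA, of vn]) auto
    have "\<beta> \<le> sum (vr i) (B i)" if i: "i \<in> N'" for i
    proof -
      have "B i \<subseteq> {1..m'}" using B(1) i by (auto simp: is_allocation_def)
      then have le: "(\<Sum>g\<in>B i. 4 * u * vn i g) \<le> sum (vr i) (B i)"
        using norm[OF i] by (intro sum_mono) auto
      have "\<beta> \<le> 4 * u * \<alpha>" by (simp add: \<beta>_def u(4))
      also have "\<dots> \<le> 4 * u * sum (vn i) (B i)"
        using A_ge[OF i] B(2)[OF i] u(1) by (intro mult_left_mono) auto
      also have "\<dots> \<le> sum (vr i) (B i)" using le by (simp add: sum_distrib_left)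
      finally show ?thesis .
    qed
    moreover have "\<beta> \<le> 1 - u" by (simp add: \<beta>_def u(3))
    ultimately obtain C where C: "is_allocation N {1..card M} C"
      "\<And>i. i \<in> N \<Longrightarrow> \<beta> \<le> sum (?v2' i) (C i)"
      using reduce_run_allocation[OF run _ B(1)] by blast
    obtain D where D: "is_allocation N M D"
      "\<And>i. i \<in> N \<Longrightarrow> sum (v1 i) (C i) \<le> sum (v i) (D i)"
      unfolding v1_def by (rule unorder_allocation[OF assms(2) C(1), of v]) auto
    have "\<beta> * mms (card N) (v i) M \<le> sum (v i) (D i)" if i: "i \<in> N" for i
    proof -
      \<comment> \<open>Undoing the scaling turns the absolute bound \<open>\<beta>\<close> into a
        multiple of the original maximin share.\<close>
      have "sum (?v2' i) (C i) = sum (v1 i) (C i) / mms (card N) (v i) M"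
        unfolding mms1[OF i] by (simp add: sum_divide_distrib)
      then have "\<beta> * mms (card N) (v i) M \<le> sum (v1 i) (C i)"
        using C(2)[OF i] pos[OF i] by (simp add: pos_le_divide_eq)
      then show ?thesis using D(2)[OF i] by linarith
    qed
    then show ?thesis using D(1) unfolding is_mms_alloc_def \<beta>_def by blast
  qed
  ultimately show ?thesis unfolding w_def by blast
qed

end
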